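(* Let \[ S_a=\begin{pmatrix}0&1&0\\1&0&1\\1&0&0\end{pmatrix},\qquad S_b=\begin{pmatrix}0&1&0\\1&0&0\\1&0&1\end{pmatrix}, \] and let $M\in\{S_a,S_b\}^n$ for some $n\ge 1$. The following are equivalent. (1) $M$ is a primitive matrix. (2) $M$ is a Pisot matrix. (3) $M^2\notin\{S_aS_b,\,S_b^2\}^n\cup\{S_bS_a,\,S_b^2\}^n$.
   Context: For a finite set $\mathcal{S}$ of square matrices of the same size and $n\ge1$, $\mathcal{S}^n$ denotes the set of all matrix products $M_1M_2\cdots M_n$ with $M_1,\dots,M_n\in\mathcal{S}$. A nonnegative square matrix is primitive if some power of it has only strictly positive entries. A nonnegative integer matrix is called a Pisot matrix if all its eigenvalues (counted with algebraic multiplicity) except the Perron–Frobenius eigenvalue (the spectral radius, counted once) have absolute value less than $1$. ($S_a$ and $S_b$ are the matrices of the Selmer continued fraction algorithm in dimension $d=2$.) *)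

theory Defs
  imports "Jordan_Normal_Form.Spectral_Radius"
begin

definition nonneg_mat :: "int mat \<Rightarrow> bool" where
  "nonneg_mat A \<longleftrightarrow> (\<forall>x \<in> elements_mat A. 0 \<le> x)"

definition pos_mat :: "int mat \<Rightarrow> bool" where
  "pos_mat A \<longleftrightarrow> (\<forall>x \<in> elements_mat A. 0 < x)"

(* Only exponents k > 0 count: otherwise every 1 x 1 matrix would be primitive, as A ^ 0 = 1. *)
definition primitive_mat :: "int mat \<Rightarrow> bool" where
  "primitive_mat A \<longleftrightarrow> square_mat A \<and> nonneg_mat A \<and> (\<exists>k>0. pos_mat (A ^\<^sub>m k))"

definition eigenvalue_mset :: "complex mat \<Rightarrow> complex multiset" where
  "eigenvalue_mset A = proots (char_poly A)"

(* The multiset difference removes a single copy of the spectral radius; by Perron-Frobenius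
   the spectral radius of a nonnegative matrix is one of its eigenvalues. *)
definition pisot_mat :: "int mat \<Rightarrow> bool" where
  "pisot_mat A \<longleftrightarrow> square_mat A \<and> nonneg_mat A \<and>
     (let C = map_mat complex_of_int A
      in \<forall>z \<in># eigenvalue_mset C - {# complex_of_real (spectral_radius C) #}. cmod z < 1)"

(* The products M_1 * ... * M_n with factors in a set S of d x d matrices;
   d serves only to name the unit matrix that closes the fold. *)
definition mat_products :: "nat \<Rightarrow> 'a :: semiring_1 mat set \<Rightarrow> nat \<Rightarrow> 'a mat set" where
  "mat_products d S n = {foldr (*) Ms (1\<^sub>m d) | Ms. length Ms = n \<and> set Ms \<subseteq> S}"

definition S_a :: "int mat" where
  "S_a = mat_of_rows_list 3
     [[0, 1, 0],
      [1, 0, 1],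
      [1, 0, 0]]"

definition S_b :: "int mat" where
  "S_b = mat_of_rows_list 3
     [[0, 1, 0],
      [1, 0, 0],
      [1, 0, 1]]"

end

theory Submission
  imports "HOL-Analysis.Brouwer_Fixpoint" Defs
begin

text \<open>
  Let N = M^2. If condition (3) fails, N fixes a coordinate functional, so no power of M is positive;
  moreover M then has the eigenvalue 1 and determinant of modulus 1, so M is not Pisot.

  If (3) holds, the letter a occurs at positions of both parities in the periodic word of M. Following the
  supports of nonnegative vectors through the word shows that M is primitive; let M r = l r with r positive
  and l > 1. The potential G(v, r), the pairing of r with a polyhedral majorant of v, does not
  decrease when v and r are both multiplied by S_a or S_b, and it is constant along the orbit only if all
  iterates of v have sign pattern (+, +, -) up to a global sign, which (3) excludes for nonzero v.
  For a real eigenvalue z with M v = z v this gives |z| l > 1. As the three eigenvalues have a product of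
  modulus 1, the two others than l are less than 1 in modulus; if they are not real, they are
  conjugate and it suffices that l > 1.
\<close>

type_synonym 'a triple = "'a \<times> 'a \<times> 'a"

section \<open>Orbits of the Selmer steps\<close>

text \<open>The action of the two matrices on column vectors, over an arbitrary ring: integer orbits
  decide primitivity, real orbits carry the Perron vector and the other real eigenvectors.\<close>

fun step :: "bool \<Rightarrow> 'a :: comm_ring_1 triple \<Rightarrow> 'a triple" where
  "step True (x, y, z) = (y, x + z, x)"
| "step False (x, y, z) = (y, x, x + z)"

primrec orbit :: "(nat \<Rightarrow> bool) \<Rightarrow> 'a :: comm_ring_1 triple \<Rightarrow> nat \<Rightarrow> 'a triple" where
  "orbit X v 0 = v"
| "orbit X v (Suc k) = step (X k) (orbit X v k)"

fun nonneg_triple :: "'a :: linordered_idom triple \<Rightarrow> bool" where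
  "nonneg_triple (x, y, z) \<longleftrightarrow> 0 \<le> x \<and> 0 \<le> y \<and> 0 \<le> z"

fun pos_triple :: "'a :: linordered_idom triple \<Rightarrow> bool" where
  "pos_triple (x, y, z) \<longleftrightarrow> 0 < x \<and> 0 < y \<and> 0 < z"

text \<open>Condition (3), read off the periodic sequence of letters: True stands for the letter a.\<close>

definition both_parities :: "(nat \<Rightarrow> bool) \<Rightarrow> bool" where
  "both_parities X \<longleftrightarrow> (\<forall>K. \<exists>m. X (K + 2 * m))"

lemma both_parities_eventually:
  assumes "both_parities X" shows "\<exists>k\<ge>K. X k"
  using assms unfolding both_parities_def by (meson le_add1)

lemma step_eq_0_iff: "step c v = (0, 0, 0) \<longleftrightarrow> v = (0, 0, 0)"
  by (cases v rule: prod_cases3; cases c) auto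

section \<open>Supports of nonnegative orbits\<close>

lemma nonneg_orbit: "nonneg_triple v \<Longrightarrow> nonneg_triple (orbit X v k)"
proof (induction k)
  case (Suc k)
  then show ?case
    by (cases "orbit X v k" rule: prod_cases3; cases "X k") auto
qed auto

lemma pos_orbit_mono:
  assumes "pos_triple (orbit X v k)" "k \<le> l" shows "pos_triple (orbit X v l)"
  using assms(2)
proof (induction l rule: dec_induct)
  case (step l)
  then show ?case by (cases "orbit X v l" rule: prod_cases3; cases "X l") auto
qed (use assms(1) in auto)

text \<open>From (0, +, +) the only way to avoid a positive triple is to apply b and then to return to
  (0, +, +) whatever the next letter is, so that one parity class of letters consists of b only.\<close>

lemma orbit_eventually_pos_0pp:
  assumes X: "both_parities X" and "orbit X v k = (0, y, z)" "0 < y" "0 < z"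
  shows "\<exists>l. pos_triple (orbit X v l)"
proof (rule ccontr)
  assume np: "\<nexists>l. pos_triple (orbit X v l)"
  have two: "\<not> X l \<and> (\<exists>y z. orbit X v (l + 2) = (0, y, z) \<and> 0 < y \<and> 0 < z)"
    if "orbit X v l = (0, y, z)" "0 < y" "0 < z" for l y z
  proof -
    have "\<not> pos_triple (orbit X v (Suc (Suc l)))" using np by blast
    then show ?thesis using that by (cases "X l"; cases "X (Suc l)") auto
  qed
  have "\<exists>y z. orbit X v (k + 2 * m) = (0, y, z) \<and> 0 < y \<and> 0 < z" for m
  proof (induction m)
    case (Suc m)
    have "k + 2 * Suc m = k + 2 * m + 2" by simp
    then show ?case using Suc two by metis
  qed (use assms in auto)
  then have "\<not> X (k + 2 * m)" for m using two by blast
  then show False using X unfolding both_parities_def by blast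
qed

text \<open>Whatever the letter, a single step leads to a positive triple if y > 0, and to the
  pattern (0, +, +) if y = 0.\<close>

lemma orbit_eventually_pos_fst:
  assumes X: "both_parities X" and "orbit X v k = (x, y, z)" "0 < x" "0 \<le> y" "0 \<le> z"
  shows "\<exists>l. pos_triple (orbit X v l)"
proof (cases "y = 0")
  case True
  then have "orbit X v (Suc k) = (0, fst (snd (orbit X v (Suc k))), snd (snd (orbit X v (Suc k))))"
    "0 < fst (snd (orbit X v (Suc k)))" "0 < snd (snd (orbit X v (Suc k)))"
    using assms by (cases "X k"; simp)+
  then show ?thesis using orbit_eventually_pos_0pp[OF X] by blast
next
  case False
  then have "pos_triple (orbit X v (Suc k))"
    using assms by (cases "X k") auto
  then show ?thesis by blast
qed

lemma orbit_eventually_pos_snd: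
  assumes X: "both_parities X" and "orbit X v k = (x, y, z)" "0 \<le> x" "0 < y" "0 \<le> z"
  shows "\<exists>l. pos_triple (orbit X v l)"
proof (cases "X k")
  case True
  show ?thesis
    by (rule orbit_eventually_pos_fst[OF X, of _ "Suc k" y "x + z" x]) (use assms True in auto)
next
  case False
  show ?thesis
    by (rule orbit_eventually_pos_fst[OF X, of _ "Suc k" y x "x + z"]) (use assms False in auto)
qed

lemma orbit_eventually_pos:
  assumes X: "both_parities X" and nn: "nonneg_triple v" and "v \<noteq> (0, 0, 0)"
  shows "\<exists>l. pos_triple (orbit X v l)"
proof (cases "\<exists>k. 0 < fst (orbit X v k) \<or> 0 < fst (snd (orbit X v k))")
  case True
  then obtain k where k: "0 < fst (orbit X v k) \<or> 0 < fst (snd (orbit X v k))" by blast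
  obtain x y z where e: "orbit X v k = (x, y, z)" by (cases "orbit X v k" rule: prod_cases3) auto
  have "0 \<le> x" "0 \<le> y" "0 \<le> z" "0 < x \<or> 0 < y"
    using nonneg_orbit[OF nn, of X k] k e by auto
  then show ?thesis
    using orbit_eventually_pos_fst[OF X e] orbit_eventually_pos_snd[OF X e] by blast
next
  \<comment> \<open>The orbit would have to stay on the third axis. The letter b fixes that axis
    pointwise, but the first a moves the entry to the second place.\<close>
  case False
  have z: "fst (orbit X v k) = 0 \<and> fst (snd (orbit X v k)) = 0 \<and> 0 < snd (snd (orbit X v k))" for k
  proof (induction k)
    case 0
    then show ?case using False[simplified, rule_format, of 0] nn assms(3)
      by (cases v rule: prod_cases3) auto
  next
    case (Suc k)
    then show ?case using False[simplified, rule_format, of "Suc k"]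
      by (cases "orbit X v k" rule: prod_cases3; cases "X k") auto
  qed
  obtain k where "X k" using both_parities_eventually[OF X, of 0] by blast
  then show ?thesis using z[of k] z[of "Suc k"] by (cases "orbit X v k" rule: prod_cases3) auto
qed

section \<open>Sign patterns of real orbits\<close>

fun sign_cone :: "real triple \<Rightarrow> bool" where
  "sign_cone (x, y, z) \<longleftrightarrow>
    0 \<le> x \<and> 0 \<le> y \<and> z \<le> 0 \<or> x \<le> 0 \<and> y \<le> 0 \<and> 0 \<le> z"

lemma orbit_leaves_sign_cone_00z:
  assumes X: "both_parities X" and "orbit X v k = (0, 0, z)" "z \<noteq> 0"
  shows "\<exists>l. \<not> sign_cone (orbit X v l)"
proof -
  \<comment> \<open>The first a from time k on; until then every letter is b and fixes (0, 0,
    z).\<close>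
  obtain l where l: "l \<ge> k" "X l" "\<And>j. k \<le> j \<Longrightarrow> j < l \<Longrightarrow> \<not> X j"
  proof -
    let ?l = "LEAST l. k \<le> l \<and> X l"
    have "k \<le> ?l \<and> X ?l"
      using both_parities_eventually[OF X, of k] by (intro LeastI_ex[where P = "\<lambda>l. k \<le> l \<and> X l"]) blast
    then show ?thesis using that[of ?l] not_less_Least by blast
  qed
  have "orbit X v l = (0, 0, z)"
    using l(1,3)
  proof (induction l rule: dec_induct)
    case (step j)
    then show ?case by (auto simp: less_Suc_eq)
  qed (use assms in auto)
  \<comment> \<open>After this a, any two letters lead through (0, z, 0) and (z, 0, 0) to (0, z, z),
    where y and z have the same strict sign.\<close>
  then have "\<not> sign_cone (orbit X v (Suc (Suc (Suc l))))"
    using assms(3) l(2) by (cases "X (Suc l)"; cases "X (Suc (Suc l))") auto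
  then show ?thesis by blast
qed

text \<open>At (0, y, z) the letter a would force z = 0, and two steps after the start the orbit
  would be at (0, y, y), outside the cone. So the letter is b, and after one more letter the pattern
  recurs. Hence all letters of one parity class would be b.\<close>

lemma orbit_leaves_sign_cone_0yz:
  assumes X: "both_parities X" and "orbit X v k = (0, y, z)" "y \<noteq> 0"
  shows "\<exists>l. \<not> sign_cone (orbit X v l)"
proof (rule ccontr)
  assume "\<nexists>l. \<not> sign_cone (orbit X v l)"
  then have sc: "sign_cone (orbit X v l)" for l by blast
  have two: "\<not> X l \<and> (\<exists>y z. orbit X v (l + 2) = (0, y, z) \<and> y \<noteq> 0)"
    if e: "orbit X v l = (0, y, z)" "y \<noteq> 0" for l y z
  proof -
    \<comment> \<open>The letter b followed by a leads to (0, y + z, y); if y + z = 0 this lies on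
      the third axis, which the preceding lemma treats.\<close>
    have "y \<noteq> - z" if "X (Suc l)" "\<not> X l"
      using orbit_leaves_sign_cone_00z[OF X, of v "l + 2" y] sc e that by auto
    then show ?thesis using e sc[of l] sc[of "Suc l"] sc[of "Suc (Suc l)"]
      by (cases "X l"; cases "X (Suc l)") auto
  qed
  have "\<exists>y z. orbit X v (k + 2 * m) = (0, y, z) \<and> y \<noteq> 0" for m
  proof (induction m)
    case (Suc m)
    have "k + 2 * Suc m = k + 2 * m + 2" by simp
    then show ?case using Suc two by metis
  qed (use assms in auto)
  then have "\<not> X (k + 2 * m)" for m using two by blast
  then show False using X unfolding both_parities_def by blast
qed

text \<open>The cone contains every vector of zero defect, so this is what makes the potential grow.
  The letter a puts y in first and x in third place. The sign conditions before and after it demand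
  both equal and opposite weak signs of x and y, so one of them is 0 and the orbit meets the plane
  of vanishing first coordinate.\<close>

lemma orbit_leaves_sign_cone:
  assumes X: "both_parities X" and "v \<noteq> (0, 0, 0)"
  shows "\<exists>l. \<not> sign_cone (orbit X v l)"
proof (rule ccontr)
  assume n: "\<nexists>l. \<not> sign_cone (orbit X v l)"
  then have sc: "sign_cone (orbit X v l)" for l by blast
  have nz: "orbit X v l \<noteq> (0, 0, 0)" for l
    by (induction l) (use assms(2) in \<open>auto simp: step_eq_0_iff\<close>)
  have n0: "fst (orbit X v l) \<noteq> 0" for l
    using orbit_leaves_sign_cone_00z[OF X, of v l] orbit_leaves_sign_cone_0yz[OF X, of v l] n nz[of l]
    by (cases "orbit X v l" rule: prod_cases3) auto
  obtain k where "X k" using both_parities_eventually[OF X, of 0] by blast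
  then have "fst (orbit X v k) = 0 \<or> fst (orbit X v (Suc k)) = 0"
    using sc[of k] sc[of "Suc k"] by (cases "orbit X v k" rule: prod_cases3) auto
  then show False using n0 by blast
qed

text \<open>The functionals were found by closing the coordinate functionals under the inverse steps: they make
  the three components of the majorant of v at most those of the transposed matrix of the step applied to
  the majorant of step c v. Only the first of these inequalities can be strict; the gap is defect v.\<close>

fun majorant :: "real triple \<Rightarrow> real triple" where
  "majorant (x, y, z) = (max \<bar>y\<bar> (max \<bar>z\<bar> \<bar>y - z\<bar>),
     max \<bar>x\<bar> (max \<bar>z\<bar> \<bar>x + z\<bar>), max \<bar>x\<bar> (max \<bar>y\<bar> \<bar>x + y\<bar>))"

fun dot :: "real triple \<Rightarrow> real triple \<Rightarrow> real" where
  "dot (x, y, z) (x', y', z') = x * x' + y * y' + z * z'"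

definition defect :: "real triple \<Rightarrow> real" where
  "defect v = (case v of (x, y, z) \<Rightarrow>
     max \<bar>y\<bar> (max \<bar>x + z\<bar> \<bar>x + y + z\<bar>) + max \<bar>x\<bar> (max \<bar>y\<bar> \<bar>x + y\<bar>) - max \<bar>y\<bar> (max \<bar>z\<bar> \<bar>y - z\<bar>))"

text \<open>The bound is the triangle inequality for z = (x + z) - x and y - z = (x + y) - (x + z),
  with \<open>A\<close> and \<open>B\<close> bounding the parts. Equality leaves no slack in these
  estimates and, with the remaining bounds in \<open>A\<close> and \<open>B\<close>, fixes the signs
  of x, y and z.\<close>

lemma defect_nonneg: "0 \<le> defect v" and sign_cone_defect_0: "defect v = 0 \<Longrightarrow> sign_cone v"
proof -
  obtain x y z where v: "v = (x, y, z)" by (cases v rule: prod_cases3)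
  define A B where "A = max \<bar>y\<bar> (max \<bar>x + z\<bar> \<bar>x + y + z\<bar>)" and "B = max \<bar>x\<bar> (max \<bar>y\<bar> \<bar>x + y\<bar>)"
  have d: "defect v = A + B - max \<bar>y\<bar> (max \<bar>z\<bar> \<bar>y - z\<bar>)"
    by (simp add: defect_def v A_def B_def)
  have A: "\<bar>y\<bar> \<le> A" "\<bar>x + z\<bar> \<le> A" "\<bar>x + y + z\<bar> \<le> A"
    and B: "\<bar>x\<bar> \<le> B" "\<bar>y\<bar> \<le> B" "\<bar>x + y\<bar> \<le> B"
    unfolding A_def B_def by auto
  have "\<bar>y\<bar> \<le> A + B" "\<bar>z\<bar> \<le> A + B" "\<bar>y - z\<bar> \<le> A + B"
    using A B by linarith+
  then show "0 \<le> defect v" unfolding d by auto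
  assume "defect v = 0"
  then consider "\<bar>y\<bar> = A + B" | "\<bar>z\<bar> = A + B" | "\<bar>y - z\<bar> = A + B"
    unfolding d by (auto simp: max_def split: if_splits)
  then show "sign_cone v"
  proof cases
    case 1
    then show ?thesis using A B unfolding v sign_cone.simps by linarith
  next
    case 2
    then show ?thesis using A B unfolding v sign_cone.simps by linarith
  next
    case 3
    then show ?thesis using A B unfolding v sign_cone.simps by linarith
  qed
qed

text \<open>For either letter the majorant of the image consists of the old second and third maxima
  and one new maximum \<open>A\<close>. Paired with the moved \<open>r\<close>, only the coefficient
  of \<open>fst r\<close> changes, from \<open>g1\<close> to \<open>A + B\<close>.\<close>

lemma dot_majorant_step:
  "dot (majorant (step c v)) (step c r) = dot (majorant v) r + fst r * defect v"
proof -
  obtain x y z p q s where vr: "v = (x, y, z)" "r = (p, q, s)"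
    by (cases v rule: prod_cases3; cases r rule: prod_cases3)
  define A B g1 g2 where "A = max \<bar>y\<bar> (max \<bar>x + z\<bar> \<bar>x + y + z\<bar>)" and "B = max \<bar>x\<bar> (max \<bar>y\<bar> \<bar>x + y\<bar>)"
    and "g1 = max \<bar>y\<bar> (max \<bar>z\<bar> \<bar>y - z\<bar>)" and "g2 = max \<bar>x\<bar> (max \<bar>z\<bar> \<bar>x + z\<bar>)"
  note abb = this
  have v: "majorant v = (g1, g2, B)" "defect v = A + B - g1"
    by (simp_all add: vr abb defect_def)
  have step: "majorant (step c v) = (if c then (g2, B, A) else (g2, A, B))"
    by (cases c) (simp_all add: vr abb ac_simps)
  show ?thesis
    unfolding step v by (cases c) (simp_all add: vr algebra_simps)
qed

section \<open>Matrices of words\<close>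

text \<open>Casting the entries lets one integer matrix act on integer, real and complex triples, so
  that primitivity, the potential and the spectrum refer to the same action.\<close>

definition mv :: "int mat \<Rightarrow> 'a :: comm_ring_1 triple \<Rightarrow> 'a triple" where
  "mv A v = (case v of (x, y, z) \<Rightarrow>
     (of_int (A $$ (0, 0)) * x + of_int (A $$ (0, 1)) * y + of_int (A $$ (0, 2)) * z,
      of_int (A $$ (1, 0)) * x + of_int (A $$ (1, 1)) * y + of_int (A $$ (1, 2)) * z,
      of_int (A $$ (2, 0)) * x + of_int (A $$ (2, 1)) * y + of_int (A $$ (2, 2)) * z))"

definition smul :: "'a :: comm_ring_1 \<Rightarrow> 'a triple \<Rightarrow> 'a triple" where
  "smul c v = (case v of (x, y, z) \<Rightarrow> (c * x, c * y, c * z))"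

lemma mv_smul: "mv A (smul c v) = smul c (mv A v)"
  by (cases v rule: prod_cases3) (simp add: mv_def smul_def algebra_simps)

lemma less_3_iff: "i < (3 :: nat) \<longleftrightarrow> i = 0 \<or> i = 1 \<or> i = 2"
  by auto

lemma all_less_3: "(\<forall>i<3 :: nat. P i) \<longleftrightarrow> P 0 \<and> P 1 \<and> P 2"
  by (auto simp: less_3_iff)

lemma index_mult_mat_3:
  fixes A B :: "'a :: comm_ring_1 mat"
  assumes "A \<in> carrier_mat 3 3" "B \<in> carrier_mat 3 3" "i < 3" "j < 3"
  shows "(A * B) $$ (i, j) = A $$ (i, 0) * B $$ (0, j) + A $$ (i, 1) * B $$ (1, j) + A $$ (i, 2) * B $$ (2, j)"
proof -
  have "{0..<3} = {0, 1, 2 :: nat}" by auto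
  then show ?thesis using assms by (simp add: scalar_prod_def)
qed

lemma mv_mult:
  assumes "A \<in> carrier_mat 3 3" "B \<in> carrier_mat 3 3"
  shows "mv (A * B) v = mv A (mv B v)"
  by (cases v rule: prod_cases3)
    (simp add: mv_def index_mult_mat_3[OF assms] algebra_simps)

lemma mv_one: "mv (1\<^sub>m 3) v = v"
  by (cases v rule: prod_cases3) (simp add: mv_def)

definition letter :: "bool \<Rightarrow> int mat" where
  "letter c = (if c then S_a else S_b)"

lemma letter_carrier: "letter c \<in> carrier_mat 3 3"
  by (rule carrier_matI) (simp_all add: letter_def S_a_def S_b_def mat_of_rows_list_def)

lemmas letter_carrier_ab = letter_carrier[of True, unfolded letter_def, simplified]
  letter_carrier[of False, unfolded letter_def, simplified]

lemma mv_letter: "mv (letter c) v = step c v"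
  by (cases v rule: prod_cases3; cases c)
    (simp_all add: mv_def letter_def S_a_def S_b_def mat_of_rows_list_def)

definition word_mat :: "bool list \<Rightarrow> int mat" where
  "word_mat w = foldr (*) (map letter w) (1\<^sub>m 3)"

lemma word_mat_simps [simp]:
  "word_mat [] = 1\<^sub>m 3" "word_mat (c # w) = letter c * word_mat w"
  by (simp_all add: word_mat_def)

lemma word_mat_carrier: "word_mat w \<in> carrier_mat 3 3"
  by (induction w) (simp_all add: mult_carrier_mat[OF letter_carrier])

lemma word_mat_append: "word_mat (u @ w) = word_mat u * word_mat w"
proof (induction u)
  case Nil
  then show ?case using left_mult_one_mat[OF word_mat_carrier] by simp
next
  case (Cons c u)
  then show ?case
    by (simp add: assoc_mult_mat[OF letter_carrier word_mat_carrier word_mat_carrier])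
qed

lemma pow_mat_2: "A \<in> carrier_mat n n \<Longrightarrow> A ^\<^sub>m 2 = A * A"
  by (simp add: numeral_2_eq_2)

lemma mat_products_letters:
  assumes "M \<in> mat_products 3 {S_a, S_b} n"
  obtains w where "length w = n" "M = word_mat w"
proof -
  obtain Ms where Ms: "M = foldr (*) Ms (1\<^sub>m 3)" "length Ms = n" "set Ms \<subseteq> {S_a, S_b}"
    using assms unfolding mat_products_def by auto
  have "map letter (map (\<lambda>A. A = S_a) Ms) = Ms"
    using Ms(3) by (auto simp: letter_def intro!: map_idI)
  then show ?thesis
    using Ms that[of "map (\<lambda>A. A = S_a) Ms"] by (simp add: word_mat_def)
qed

lemma word_mat_in_mat_products_pairs:
  assumes "length u = 2 * n" "\<And>i. i < n \<Longrightarrow> letter (u ! (2 * i)) * letter (u ! (2 * i + 1)) \<in> S"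
  shows "word_mat u \<in> mat_products 3 S n"
  using assms
proof (induction n arbitrary: u)
  case 0
  then show ?case by (auto simp: mat_products_def intro!: exI[of _ "[]"])
next
  case (Suc n)
  then obtain c d u' where u: "u = c # d # u'" by (cases u; cases "tl u") auto
  have "word_mat u' \<in> mat_products 3 S n"
    using Suc.IH[of u'] Suc.prems(1) Suc.prems(2)[of "Suc i" for i] u by simp
  then obtain Ms where Ms: "word_mat u' = foldr (*) Ms (1\<^sub>m 3)" "length Ms = n" "set Ms \<subseteq> S"
    unfolding mat_products_def by auto
  have "letter c * letter d \<in> S" using Suc.prems(2)[of 0] u by simp
  moreover have "word_mat u = (letter c * letter d) * word_mat u'"
    by (simp add: u assoc_mult_mat[OF letter_carrier letter_carrier word_mat_carrier])
  ultimately have "word_mat u = foldr (*) ((letter c * letter d) # Ms) (1\<^sub>m 3)"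
    "length ((letter c * letter d) # Ms) = Suc n" "set ((letter c * letter d) # Ms) \<subseteq> S"
    using Ms by simp_all
  then show ?case unfolding mat_products_def by blast
qed

text \<open>The doubled word has even length also for odd \<open>n\<close> and splits into
  \<open>n\<close> blocks of two letters. If b fills all the second places, each block is ab or bb;
  if it fills all the first places, each is ba or bb.\<close>

lemma square_in_mat_products:
  assumes "length w = n" "M = word_mat w"
  shows "(\<And>i. i < n \<Longrightarrow> \<not> (w @ w) ! (2 * i + 1)) \<Longrightarrow> M ^\<^sub>m 2 \<in> mat_products 3 {S_a * S_b, S_b ^\<^sub>m 2} n"
    and "(\<And>i. i < n \<Longrightarrow> \<not> (w @ w) ! (2 * i)) \<Longrightarrow> M ^\<^sub>m 2 \<in> mat_products 3 {S_b * S_a, S_b ^\<^sub>m 2} n"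
proof -
  have M: "M ^\<^sub>m 2 = word_mat (w @ w)"
    by (simp add: assms pow_mat_2[OF word_mat_carrier] word_mat_append)
  have b: "S_b ^\<^sub>m 2 = S_b * S_b" by (rule pow_mat_2[OF letter_carrier_ab(2)])
  show "M ^\<^sub>m 2 \<in> mat_products 3 {S_a * S_b, S_b ^\<^sub>m 2} n"
    if "\<And>i. i < n \<Longrightarrow> \<not> (w @ w) ! (2 * i + 1)"
    unfolding M using that assms(1) by (intro word_mat_in_mat_products_pairs) (auto simp: letter_def b)
  show "M ^\<^sub>m 2 \<in> mat_products 3 {S_b * S_a, S_b ^\<^sub>m 2} n"
    if "\<And>i. i < n \<Longrightarrow> \<not> (w @ w) ! (2 * i)"
    unfolding M using that assms(1) by (intro word_mat_in_mat_products_pairs) (auto simp: letter_def b)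
qed

text \<open>The word is reversed because the last factor of a product acts first.\<close>

definition periodic_word :: "bool list \<Rightarrow> nat \<Rightarrow> bool" where
  "periodic_word w k = rev w ! (k mod length w)"

lemma mv_word_mat: "mv (word_mat w) v = foldr step w v"
  by (induction w) (simp_all add: mv_one mv_mult[OF letter_carrier word_mat_carrier] mv_letter)

lemma foldr_step_orbit:
  "(\<And>k. k < length w \<Longrightarrow> X k = rev w ! k) \<Longrightarrow> foldr step w v = orbit X v (length w)"
proof (induction w)
  case (Cons c w)
  have "foldr step w v = orbit X v (length w)"
    by (rule Cons.IH) (use Cons.prems in \<open>auto simp: nth_append less_SucI\<close>)
  then show ?case using Cons.prems[of "length w"] by (simp add: nth_append)
qed simp

lemma orbit_add: "orbit X v (k + l) = orbit (\<lambda>i. X (k + i)) (orbit X v k) l"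
  by (induction l) auto

lemma orbit_periodic_word: "orbit (periodic_word w) v (length w) = mv (word_mat w) v"
  unfolding mv_word_mat by (rule foldr_step_orbit[symmetric]) (simp add: periodic_word_def)

lemma orbit_periodic_word_mult:
  "orbit (periodic_word w) v (length w * m) = (mv (word_mat w) ^^ m) v"
proof (induction m)
  case (Suc m)
  have "periodic_word w (length w * m + i) = periodic_word w i" for i
    by (simp add: periodic_word_def)
  then show ?case
    using orbit_add[of "periodic_word w" v "length w * m" "length w"]
    by (simp add: Suc add.commute orbit_periodic_word)
qed simp

lemma both_parities_periodic_word:
  assumes n: "length w = n" "1 \<le> n"
    and i: "i < n" "(w @ w) ! (2 * i + 1)" and j: "j < n" "(w @ w) ! (2 * j)"
  shows "both_parities (periodic_word w)"
  unfolding both_parities_def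
proof
  fix K
  \<comment> \<open>Reversal sends position \<open>l\<close> of the doubled word to
    \<open>2 * n - 1 - l\<close>, which has the other parity.\<close>
  have per: "periodic_word w (2 * n - 1 - l + n * m)" if "l < 2 * n" "(w @ w) ! l" for l m
  proof -
    have "rev (w @ w) ! (2 * n - 1 - l) = (w @ w) ! l"
      using that n by (subst rev_nth) (auto simp: mult_2)
    moreover have "rev (w @ w) ! k = rev w ! (k mod n)" if "k < 2 * n" for k
      using that n by (auto simp: nth_append le_mod_geq)
    ultimately have "rev w ! ((2 * n - 1 - l) mod n)" using that n by auto
    then show ?thesis unfolding periodic_word_def n(1) by (simp only: mod_mult_self2)
  qed
  obtain l where l: "l < 2 * n" "(w @ w) ! l" "odd (l + K)"
    using i j that[of "2 * i + 1"] that[of "2 * j"] by (cases "even K") auto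
  \<comment> \<open>An even number of periods preserves the parity even when \<open>n\<close> is
    odd; \<open>2 * K\<close> of them carry the position to at least \<open>K\<close>.\<close>
  define p where "p = 2 * n - 1 - l + n * (2 * K)"
  have "K \<le> n * (2 * K)" using n(2) by (cases n) auto
  then have "K \<le> p" unfolding p_def by (rule trans_le_add2)
  moreover have "even (p - K)"
  proof -
    have "odd (2 * n - 1 - l) \<longleftrightarrow> even l" using l(1) by presburger
    then have "even (p + K)" using l(3) by (auto simp: p_def)
    then show ?thesis using \<open>K \<le> p\<close> by presburger
  qed
  ultimately obtain m where "p = K + 2 * m" by (metis evenE le_add_diff_inverse)
  then show "\<exists>m. periodic_word w (K + 2 * m)" using per[OF l(1,2), of "2 * K"] by (auto simp: p_def)
qed

section \<open>Words violating condition (3): an invariant coordinate functional\<close>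

definition fixed_row :: "nat \<Rightarrow> int mat \<Rightarrow> bool" where
  "fixed_row i A \<longleftrightarrow> A \<in> carrier_mat 3 3 \<and> (\<forall>j<3. A $$ (i, j) = (if j = i then 1 else 0))"

lemma fixed_row_one: "i < 3 \<Longrightarrow> fixed_row i (1\<^sub>m 3)"
  by (auto simp: fixed_row_def)

lemma fixed_row_mult:
  assumes i: "i < 3" and A: "fixed_row i A" and B: "fixed_row i B"
  shows "fixed_row i (A * B)"
proof -
  have c: "A \<in> carrier_mat 3 3" "B \<in> carrier_mat 3 3"
    using A B by (simp_all add: fixed_row_def)
  have "(A * B) $$ (i, j) = B $$ (i, j)" if j: "j < 3" for j
  proof -
    have a: "A $$ (i, 0) = (if 0 = i then 1 else 0)" "A $$ (i, 1) = (if 1 = i then 1 else 0)"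
      "A $$ (i, 2) = (if 2 = i then 1 else 0)"
      using A by (simp_all add: fixed_row_def)
    consider "i = 0" | "i = 1" | "i = 2" using i by linarith
    then show ?thesis
      unfolding index_mult_mat_3[OF c i j] a by cases simp_all
  qed
  then show ?thesis using B mult_carrier_mat[OF c] by (simp add: fixed_row_def)
qed

lemma fixed_row_pow: "i < 3 \<Longrightarrow> fixed_row i A \<Longrightarrow> fixed_row i (A ^\<^sub>m k)"
proof (induction k)
  case 0
  then have "dim_row A = 3" by (auto simp: fixed_row_def)
  then show ?case using fixed_row_one[of i] 0 by simp
qed (simp add: fixed_row_mult)

lemma fixed_row_mat_products:
  assumes "i < 3" "\<And>A. A \<in> S \<Longrightarrow> fixed_row i A" "B \<in> mat_products 3 S n"
  shows "fixed_row i B"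
proof -
  obtain Ms where "B = foldr (*) Ms (1\<^sub>m 3)" "set Ms \<subseteq> S"
    using assms(3) unfolding mat_products_def by auto
  moreover have "set Ms \<subseteq> S \<Longrightarrow> fixed_row i (foldr (*) Ms (1\<^sub>m 3))" for Ms
    by (induction Ms) (auto intro: fixed_row_one fixed_row_mult assms)
  ultimately show ?thesis by simp
qed

text \<open>Row 0 of either letter is (0, 1, 0) and row 1 of \<open>S_b\<close> is (1, 0, 0). So row
  0 of a block ending in b is row 1 of \<open>S_b\<close>, and row 1 of a block beginning with b is
  row 0 of the other factor.\<close>

lemma fixed_row_letter_pairs:
  "fixed_row 0 (S_a * S_b)" "fixed_row 0 (S_b ^\<^sub>m 2)" "fixed_row 1 (S_b * S_a)" "fixed_row 1 (S_b ^\<^sub>m 2)"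
  unfolding pow_mat_2[OF letter_carrier_ab(2)] fixed_row_def all_less_3
  by (simp_all add: index_mult_mat_3 letter_carrier_ab mult_carrier_mat[OF letter_carrier_ab(1) letter_carrier_ab(2)]
    mult_carrier_mat[OF letter_carrier_ab(2) letter_carrier_ab(1)] mult_carrier_mat[OF letter_carrier_ab(2) letter_carrier_ab(2)])
   (simp_all add: S_a_def S_b_def mat_of_rows_list_def)

lemma reducible_fixed_row:
  assumes "A \<in> mat_products 3 {S_a * S_b, S_b ^\<^sub>m 2} n \<union> mat_products 3 {S_b * S_a, S_b ^\<^sub>m 2} n"
  obtains i where "i < 3" "fixed_row i A"
proof -
  have "fixed_row 0 A \<or> fixed_row 1 A"
    using assms fixed_row_letter_pairs
      fixed_row_mat_products[of 0 "{S_a * S_b, S_b ^\<^sub>m 2}" A n]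
      fixed_row_mat_products[of 1 "{S_b * S_a, S_b ^\<^sub>m 2}" A n]
    by fastforce
  then show ?thesis using that[of 0] that[of 1] by auto
qed

lemma mv_pow: "A \<in> carrier_mat 3 3 \<Longrightarrow> mv (A ^\<^sub>m k) v = (mv A ^^ k) v"
  by (induction k arbitrary: v) (auto simp: mv_one mv_mult funpow_swap1)

lemma pos_triple_mv:
  assumes P: "pos_mat P" "P \<in> carrier_mat 3 3" and v: "nonneg_triple v" "v \<noteq> (0, 0, 0 :: int)"
  shows "pos_triple (mv P v)"
proof -
  obtain x y z where e: "v = (x, y, z)" by (cases v rule: prod_cases3)
  have P: "0 < P $$ (i, j)" if "i < 3" "j < 3" for i j
    using P that unfolding pos_mat_def by (auto intro: elements_matI)
  have "0 < P $$ (i, 0) * x + P $$ (i, 1) * y + P $$ (i, 2) * z" if i: "i < 3" for i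
  proof -
    have "x > 0 \<or> y > 0 \<or> z > 0" using v by (auto simp: e)
    moreover have "0 \<le> P $$ (i, 0) * x" "0 \<le> P $$ (i, 1) * y" "0 \<le> P $$ (i, 2) * z"
      using v P[OF i, of 0] P[OF i, of 1] P[OF i, of 2] by (auto simp: e)
    moreover have "x > 0 \<Longrightarrow> 0 < P $$ (i, 0) * x" "y > 0 \<Longrightarrow> 0 < P $$ (i, 1) * y"
      "z > 0 \<Longrightarrow> 0 < P $$ (i, 2) * z"
      using P[OF i, of 0] P[OF i, of 1] P[OF i, of 2] by auto
    ultimately show ?thesis by linarith
  qed
  then show ?thesis by (simp add: e mv_def)
qed

lemma mv_fixed_row:
  fixes v :: "'a :: comm_ring_1 triple"
  assumes "fixed_row i A"
  shows "i = 0 \<Longrightarrow> fst (mv A v) = fst v" "i = 1 \<Longrightarrow> fst (snd (mv A v)) = fst (snd v)"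
    "i = 2 \<Longrightarrow> snd (snd (mv A v)) = snd (snd v)"
  using assms by (cases v rule: prod_cases3; simp add: fixed_row_def mv_def all_less_3)+

text \<open>If M^k were positive, so would be its square (M^2)^k; but this matrix fixes coordinate
  \<open>i\<close> of every vector.\<close>

lemma not_primitive_fixed_row:
  assumes M: "M \<in> carrier_mat 3 3" and i: "i < 3" "fixed_row i (M ^\<^sub>m 2)"
  shows "\<not> primitive_mat M"
proof
  assume "primitive_mat M"
  then obtain k where k: "pos_mat (M ^\<^sub>m k)" unfolding primitive_mat_def by blast
  have Mk: "M ^\<^sub>m k \<in> carrier_mat 3 3" using M by simp
  have "mv (M ^\<^sub>m k) (mv (M ^\<^sub>m k) v) = mv ((M ^\<^sub>m 2) ^\<^sub>m k) v" for v :: "int triple"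
  proof -
    have "mv (M ^\<^sub>m 2) = (mv M ^^ 2 :: int triple \<Rightarrow> _)"
      by (rule ext) (rule mv_pow[OF M])
    then show ?thesis
      unfolding mv_pow[OF M] mv_pow[OF pow_carrier_mat[OF M]]
      by (simp add: funpow_mult mult_2 funpow_add)
  qed
  moreover have "pos_triple (mv (M ^\<^sub>m k) (mv (M ^\<^sub>m k) v))" if "nonneg_triple v" "v \<noteq> (0, 0, 0)" for v :: "int triple"
  proof -
    have "pos_triple (mv (M ^\<^sub>m k) v)" using pos_triple_mv[OF k Mk that] .
    then show ?thesis
      by (intro pos_triple_mv[OF k Mk]) (cases "mv (M ^\<^sub>m k) v" rule: prod_cases3; auto)+
  qed
  ultimately have pos: "pos_triple (mv ((M ^\<^sub>m 2) ^\<^sub>m k) v)" if "nonneg_triple v" "v \<noteq> (0, 0, 0)" for v :: "int triple"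
    using that by simp
  have pos_fst: "0 < fst v \<and> 0 < fst (snd v) \<and> 0 < snd (snd v)" if "pos_triple v" for v :: "int triple"
    using that by (cases v rule: prod_cases3) auto
  show False
    \<comment> \<open>A unit vector with entry 0 at place \<open>i\<close> keeps that zero: (0, 0,
      1) serves for i = 0 and i = 1, and (1, 0, 0) for i = 2.\<close>
    using mv_fixed_row[OF fixed_row_pow[OF i, of k], of "(0, 0, 1) :: int triple"]
      mv_fixed_row[OF fixed_row_pow[OF i, of k], of "(1, 0, 0) :: int triple"]
      pos[of "(0, 0, 1)", THEN pos_fst] pos[of "(1, 0, 0)", THEN pos_fst] i(1)
    by (auto simp: less_3_iff)
qed

section \<open>The Perron eigenvector\<close>

definition tsum :: "real triple \<Rightarrow> real" where
  "tsum v = fst v + fst (snd v) + snd (snd v)"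

text \<open>Both matrices have column sums 2, 1, 1.\<close>

lemma tsum_step: "tsum (step c v) = tsum v + fst v"
  by (cases v rule: prod_cases3; cases c) (simp_all add: tsum_def)

lemma nonneg_triple_fst: "nonneg_triple v \<Longrightarrow> 0 \<le> fst v"
  by (cases v rule: prod_cases3) simp

lemma tsum_orbit_mono:
  assumes "nonneg_triple v" "k \<le> l"
  shows "tsum (orbit X v k) \<le> tsum (orbit X v l)"
  using assms(2)
proof (induction l rule: dec_induct)
  case (step l)
  then show ?case
    using nonneg_triple_fst[OF nonneg_orbit[OF assms(1), of X l]] by (simp add: tsum_step)
qed simp

lemma pos_imp_nonneg_triple: "pos_triple v \<Longrightarrow> nonneg_triple v"
  by (cases v rule: prod_cases3) simp

lemma tsum_orbit_less:
  assumes "pos_triple v" "1 \<le> n"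
  shows "tsum v < tsum (orbit X v n)"
proof -
  have "tsum v < tsum (orbit X v 1)"
    using assms(1) by (cases v rule: prod_cases3) (simp add: tsum_step)
  also have "\<dots> \<le> tsum (orbit X v n)"
    using tsum_orbit_mono[OF pos_imp_nonneg_triple[OF assms(1)] assms(2)] .
  finally show ?thesis .
qed

lemma tsum_smul: "tsum (smul c v) = c * tsum v"
  by (cases v rule: prod_cases3) (simp add: tsum_def smul_def algebra_simps)

lemma smul_smul: "smul c (smul d v) = smul (c * d) v"
  by (cases v rule: prod_cases3) (simp add: smul_def algebra_simps)

lemma smul_1: "smul 1 v = v"
  by (cases v rule: prod_cases3) (simp add: smul_def)

lemma mv_funpow_eigen: "mv A v = smul c v \<Longrightarrow> (mv A ^^ m) v = smul (c ^ m) v"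
  by (induction m) (simp_all add: smul_1 mv_smul smul_smul mult.commute)

text \<open>Brouwer's fixed point theorem on the standard simplex, for the action of the word
  followed by division by the coordinate sum. That sum never drops below 1 there, so the normalised
  map is continuous and the eigenvalue is at least 1.\<close>

lemma perron_vector:
  fixes w :: "bool list"
  assumes "w \<noteq> []" and X: "both_parities (periodic_word w)"
  obtains r :: "real triple" and l where "pos_triple r" "1 < l" "mv (word_mat w) r = smul l r"
proof -
  define T :: "real triple \<Rightarrow> real triple" where "T = mv (word_mat w)"
  define S :: "real triple set" where "S = {v. nonneg_triple v \<and> tsum v = 1}"
  have S_alt: "S = {v. 0 \<le> fst v} \<inter> {v. 0 \<le> fst (snd v)} \<inter> {v. 0 \<le> snd (snd v)} \<inter> {v. tsum v = 1}"
    by (auto simp: S_def)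
  have T_orbit: "T v = orbit (periodic_word w) v (length w)" for v
    by (simp add: T_def orbit_periodic_word)
  have T_nonneg: "nonneg_triple v \<Longrightarrow> nonneg_triple (T v)" for v
    unfolding T_orbit by (rule nonneg_orbit)
  have T_ge: "1 \<le> tsum (T v)" if "v \<in> S" for v
    using tsum_orbit_mono[of v 0 "length w" "periodic_word w"] that by (simp add: S_def T_orbit)
  have "compact S"
    unfolding compact_eq_bounded_closed
  proof
    have "S \<subseteq> cbox (0, 0, 0) (1, 1, 1)"
      by (auto simp: S_def cbox_Pair_eq tsum_def)
    then show "bounded S" using bounded_cbox bounded_subset by blast
    show "closed S" unfolding S_alt tsum_def
      by (intro closed_Int closed_Collect_le closed_Collect_eq continuous_intros)
  qed
  moreover have "convex S"
  proof (rule convexI)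
    fix a b :: "real triple" and s t :: real
    assume ab: "a \<in> S" "b \<in> S" and st: "0 \<le> s" "0 \<le> t" "s + t = 1"
    have "tsum (s *\<^sub>R a + t *\<^sub>R b) = s * tsum a + t * tsum b"
      by (simp add: tsum_def algebra_simps)
    then show "s *\<^sub>R a + t *\<^sub>R b \<in> S"
      using ab st unfolding S_alt by simp
  qed
  moreover have "(1, 0, 0) \<in> S" by (simp add: S_def tsum_def)
  moreover have "continuous_on S (\<lambda>v. smul (1 / tsum (T v)) (T v))"
  proof -
    have T: "continuous_on S T"
      unfolding T_def mv_def[abs_def] case_prod_beta' by (intro continuous_intros)
    have s: "smul c v = (c * fst v, c * fst (snd v), c * snd (snd v))" for c and v :: "real triple"
      by (auto simp: smul_def split: prod.split)
    have "tsum (T v) \<noteq> 0" if "v \<in> S" for v using T_ge[OF that] by simp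
    then show ?thesis unfolding s
      by (auto simp: tsum_def intro!: continuous_intros T)
  qed
  moreover have "smul (1 / tsum (T v)) (T v) \<in> S" if v: "v \<in> S" for v
  proof -
    have "tsum (smul (1 / tsum (T v)) (T v)) = 1" using T_ge[OF v] by (simp add: tsum_smul)
    moreover have "nonneg_triple (smul (1 / tsum (T v)) (T v))"
      using T_nonneg[of v] v T_ge[OF v] by (cases "T v" rule: prod_cases3) (simp add: S_def smul_def)
    ultimately show ?thesis by (simp add: S_def)
  qed
  ultimately obtain r where r: "r \<in> S" "smul (1 / tsum (T r)) (T r) = r"
    using brouwer[of S "\<lambda>v. smul (1 / tsum (T v)) (T v)"] by blast
  define l where "l = tsum (T r)"
  have l1: "1 \<le> l" using T_ge[OF r(1)] by (simp add: l_def)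
  have Tr: "T r = smul l r"
  proof -
    have "smul l r = smul l (smul (1 / l) (T r))" using r(2) by (simp add: l_def)
    also have "\<dots> = T r" using l1 by (simp add: smul_smul smul_1)
    finally show ?thesis by simp
  qed
  have "nonneg_triple r" "r \<noteq> (0, 0, 0)" using r(1) by (auto simp: S_def tsum_def)
  from orbit_eventually_pos[OF X this]
  obtain k where k: "pos_triple (orbit (periodic_word w) r k)" by blast
  \<comment> \<open>The time is rounded up to whole periods, where the orbit of \<open>r\<close>
    consists of multiples of \<open>r\<close>; so positivity passes back to \<open>r\<close>
    itself.\<close>
  have "k \<le> length w * k" using assms(1) by (cases w) auto
  from pos_orbit_mono[OF k this] have "pos_triple (smul (l ^ k) r)"
    using mv_funpow_eigen[OF Tr[unfolded T_def]] by (simp add: orbit_periodic_word_mult)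
  then have pos: "pos_triple r"
    using l1 by (cases r rule: prod_cases3) (simp add: smul_def zero_less_mult_iff)
  have "tsum r < tsum (T r)"
    unfolding T_orbit by (rule tsum_orbit_less[OF pos]) (use assms(1) in \<open>cases w; simp\<close>)
  then have "1 < l" using r(1) by (simp add: l_def S_def)
  then show ?thesis using that pos Tr by (simp add: T_def)
qed

section \<open>Eigenvalues\<close>

lemma majorant_smul: "majorant (smul c v) = smul \<bar>c\<bar> (majorant v)"
proof (cases v rule: prod_cases3)
  case (fields x y z)
  have m: "max (\<bar>c\<bar> * a) (max (\<bar>c\<bar> * b) (\<bar>c\<bar> * d)) = \<bar>c\<bar> * max a (max b d)" for a b d :: real
    by (simp add: max_mult_distrib_left)
  show ?thesis
    unfolding fields smul_def by (simp add: m[symmetric] abs_mult flip: distrib_left right_diff_distrib)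
qed

lemma dot_smul_smul: "dot (smul a v) (smul b r) = a * b * dot v r"
  by (cases v rule: prod_cases3; cases r rule: prod_cases3) (simp add: smul_def algebra_simps)

lemma dot_majorant_pos:
  assumes "pos_triple r" "v \<noteq> (0, 0, 0)"
  shows "0 < dot (majorant v) r"
proof -
  obtain x y z p q s where vr: "v = (x, y, z)" "r = (p, q, s)"
    by (cases v rule: prod_cases3; cases r rule: prod_cases3)
  have r: "0 < p" "0 < q" "0 < s" using assms(1) by (simp_all add: vr)
  define a b c where "a = max \<bar>y\<bar> (max \<bar>z\<bar> \<bar>y - z\<bar>)"
    and "b = max \<bar>x\<bar> (max \<bar>z\<bar> \<bar>x + z\<bar>)" and "c = max \<bar>x\<bar> (max \<bar>y\<bar> \<bar>x + y\<bar>)"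
  have "0 \<le> a" "0 \<le> b" "0 \<le> c" unfolding a_def b_def c_def by auto
  \<comment> \<open>The second and third maxima together bound all three coordinates of
    \<open>v\<close>.\<close>
  moreover have "0 < b \<or> 0 < c" using assms(2) unfolding b_def c_def vr by (auto simp: less_max_iff_disj)
  ultimately have "0 \<le> a * p" "0 \<le> b * q" "0 \<le> c * s" "0 < b * q \<or> 0 < c * s"
    using r by auto
  then have "0 < a * p + b * q + c * s" by linarith
  then show ?thesis by (simp add: vr a_def b_def c_def)
qed

text \<open>Each period multiplies the potential \<open>D\<close> by |z| l. Were this factor at most
  1, the nondecreasing \<open>D\<close> would be constant, all defects would vanish, and the orbit
  of \<open>u\<close> would never leave the sign cone.\<close>

lemma abs_eigenvalue_times_perron_gt_1:
  fixes u r :: "real triple" and z l :: real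
  assumes "w \<noteq> []" and X: "both_parities (periodic_word w)"
    and r: "pos_triple r" "mv (word_mat w) r = smul l r" and "0 < l"
    and u: "u \<noteq> (0, 0, 0)" "mv (word_mat w) u = smul z u"
  shows "1 < \<bar>z\<bar> * l"
proof (rule ccontr)
  assume "\<not> 1 < \<bar>z\<bar> * l"
  then have le: "\<bar>z\<bar> * l \<le> 1" by simp
  define X where "X = periodic_word w"
  define D where "D k = dot (majorant (orbit X u k)) (orbit X r k)" for k
  have pos: "pos_triple (orbit X r k)" for k
    by (rule pos_orbit_mono[of _ _ 0]) (use r in auto)
  have pos_fst: "0 < fst (orbit X r k)" for k
    using pos[of k] by (cases "orbit X r k" rule: prod_cases3) simp
  have D_Suc: "D (Suc k) = D k + fst (orbit X r k) * defect (orbit X u k)" for k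
    by (simp add: D_def dot_majorant_step)
  have "D k \<le> D (Suc k)" for k
    using pos_fst[of k] defect_nonneg[of "orbit X u k"] by (simp add: D_Suc)
  then have mono: "D k \<le> D j" if "k \<le> j" for k j
    using that by (rule lift_Suc_mono_le)
  have D0: "0 < D 0" using dot_majorant_pos[OF r(1) u(1)] by (simp add: D_def)
  have "D (length w * m) = (\<bar>z\<bar> * l) ^ m * D 0" for m
    unfolding D_def X_def orbit_periodic_word_mult mv_funpow_eigen[OF r(2)] mv_funpow_eigen[OF u(2)]
    by (simp add: majorant_smul dot_smul_smul power_abs power_mult_distrib)
  moreover have "(\<bar>z\<bar> * l) ^ m * D 0 \<le> 1 * D 0" for m
    using le D0 \<open>0 < l\<close> by (intro mult_right_mono power_le_one) auto
  ultimately have D_le: "D (length w * m) \<le> D 0" for m by simp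
  have "defect (orbit X u k) = 0" for k
  proof -
    have "Suc k \<le> length w * Suc k" using assms(1) by (cases w) auto
    then have "D (Suc k) \<le> D k" using mono[of "Suc k"] D_le[of "Suc k"] mono[of 0 k] by fastforce
    then have "fst (orbit X r k) * defect (orbit X u k) \<le> 0" unfolding D_Suc by simp
    then show ?thesis using pos_fst[of k] defect_nonneg[of "orbit X u k"] by (simp add: mult_le_0_iff)
  qed
  then have "sign_cone (orbit X u k)" for k by (rule sign_cone_defect_0)
  then show False using orbit_leaves_sign_cone[OF assms(2) u(1)] by (simp add: X_def)
qed

lemma eigenvalue_iff_triple:
  assumes A: "A \<in> carrier_mat 3 3"
  shows "poly (char_poly (map_mat complex_of_int A)) z = 0 \<longleftrightarrow>
    (\<exists>v :: complex triple. v \<noteq> (0, 0, 0) \<and> mv A v = smul z v)"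
proof -
  define C where "C = map_mat complex_of_int A"
  have C: "C \<in> carrier_mat 3 3" using A by (simp add: C_def)
  have entry: "C $$ (i, j) = of_int (A $$ (i, j))" if "i < 3" "j < 3" for i j
    using A that by (simp add: C_def)
  have interval: "{0..<3} = {0, 1, 2 :: nat}" by auto
  have vec_eq: "u = v \<longleftrightarrow> vec_index u 0 = vec_index v 0 \<and> vec_index u 1 = vec_index v 1 \<and> vec_index u 2 = vec_index v 2"
    if "u \<in> carrier_vec 3" "v \<in> carrier_vec 3" for u v :: "complex Matrix.vec"
  proof -
    have "u = v \<longleftrightarrow> (\<forall>i<3. vec_index u i = vec_index v i)" using that by (auto intro: eq_vecI)
    then show ?thesis by (simp add: all_less_3)
  qed
  have eig: "eigenvector C v z \<longleftrightarrow>
      (vec_index v 0, vec_index v 1, vec_index v 2) \<noteq> (0, 0, 0) \<and> mv A (vec_index v 0, vec_index v 1, vec_index v 2) = smul z (vec_index v 0, vec_index v 1, vec_index v 2)"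
    if v: "v \<in> carrier_vec 3" for v
  proof -
    have Cv: "vec_index (C *\<^sub>v v) i = C $$ (i, 0) * vec_index v 0 + C $$ (i, 1) * vec_index v 1 + C $$ (i, 2) * vec_index v 2" if "i < 3" for i
      using C v that by (simp add: scalar_prod_def interval)
    have "C *\<^sub>v v = z \<cdot>\<^sub>v v \<longleftrightarrow> mv A (vec_index v 0, vec_index v 1, vec_index v 2) = smul z (vec_index v 0, vec_index v 1, vec_index v 2)"
      using v by (subst vec_eq) (simp_all add: Cv entry mv_def smul_def mult_mat_vec_carrier[OF C v] del: index_mult_mat_vec)
    moreover have "v = 0\<^sub>v 3 \<longleftrightarrow> (vec_index v 0, vec_index v 1, vec_index v 2) = (0, 0, 0)"
      using v by (subst vec_eq) simp_all
    ultimately show ?thesis using C v by (simp add: eigenvector_def)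
  qed
  have "eigenvalue C z \<longleftrightarrow> (\<exists>v :: complex triple. v \<noteq> (0, 0, 0) \<and> mv A v = smul z v)"
  proof
    assume "eigenvalue C z"
    then obtain v where v: "eigenvector C v z" unfolding eigenvalue_def by blast
    then have "v \<in> carrier_vec 3" using C by (simp add: eigenvector_def)
    with v eig show "\<exists>v :: complex triple. v \<noteq> (0, 0, 0) \<and> mv A v = smul z v" by blast
  next
    assume "\<exists>v :: complex triple. v \<noteq> (0, 0, 0) \<and> mv A v = smul z v"
    then obtain a b c where v: "(a, b, c) \<noteq> (0, 0, 0)" "mv A (a, b, c) = smul z (a, b, c)" by auto
    have "eigenvector C (Matrix.vec 3 (\<lambda>i. [a, b, c] ! i)) z"
      by (subst eig) (use v in simp_all)
    then show "eigenvalue C z" unfolding eigenvalue_def by blast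
  qed
  then show ?thesis using eigenvalue_root_char_poly[OF C] by (simp add: C_def)
qed

lemma abs_det_letter: "\<bar>det (letter c)\<bar> = 1"
proof -
  \<comment> \<open>The inverse of the letter. As it is integral, the determinant is a unit of the
    integers.\<close>
  define B where "B = (if c then mat_of_rows_list 3 [[0, 0, 1], [1, 0, 0], [0, 1, -1]]
    else mat_of_rows_list 3 [[0, 1, 0], [1, 0, 0], [0, -1, 1 :: int]])"
  have B: "B \<in> carrier_mat 3 3"
    by (rule carrier_matI) (simp_all add: B_def mat_of_rows_list_def)
  have "\<forall>i<3. \<forall>j<3. (letter c * B) $$ (i, j) = 1\<^sub>m 3 $$ (i, j)"
    unfolding all_less_3
    by (simp add: index_mult_mat_3[OF letter_carrier B] del: index_mult_mat)
      (cases c; simp add: letter_def S_a_def S_b_def B_def mat_of_rows_list_def)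
  then have "letter c * B = 1\<^sub>m 3"
    using B letter_carrier[of c] by (intro eq_matI) auto
  then have "det (letter c) * det B = 1" using det_mult[OF letter_carrier B, of c] by simp
  then show ?thesis by (metis abs_zmult_eq_1 abs_one)
qed

lemma abs_det_word_mat: "\<bar>det (word_mat w)\<bar> = 1"
  by (induction w) (simp_all add: det_mult[OF letter_carrier word_mat_carrier] abs_mult abs_det_letter)

text \<open>The product of the roots is read off the constant term of the characteristic polynomial.
  The known root is listed first so that it can be told apart from the remaining two.\<close>

lemma char_poly_roots:
  assumes A: "A \<in> carrier_mat 3 3" and det: "\<bar>det A\<bar> = 1"
    and x: "poly (char_poly (map_mat complex_of_int A)) x = 0"
  obtains b c where "eigenvalue_mset (map_mat complex_of_int A) = {#x, b, c#}" "cmod x * cmod b * cmod c = 1"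
    "\<And>z. poly (char_poly (map_mat complex_of_int A)) z = 0 \<longleftrightarrow> z \<in> {x, b, c}"
proof -
  define C where "C = map_mat complex_of_int A"
  have C: "C \<in> carrier_mat 3 3" using A by (simp add: C_def)
  obtain as where as: "char_poly C = (\<Prod>a\<leftarrow>as. [:- a, 1:])" "length as = 3"
    using char_poly_factorized[OF C] by blast
  then obtain a b c where abc: "as = [a, b, c]"
    by (auto simp: numeral_3_eq_3 length_Suc_conv)
  have cp: "char_poly C = [:- a, 1:] * ([:- b, 1:] * [:- c, 1:])" by (simp add: as(1) abc del: mult_pCons_left mult_pCons_right)
  have mset: "eigenvalue_mset C = {#a, b, c#}"
    unfolding eigenvalue_mset_def cp by (subst proots_mult; simp del: mult_pCons_left mult_pCons_right)+
  have norm: "cmod a * cmod b * cmod c = 1"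
  proof -
    have "poly (char_poly C) 0 = det (- char_matrix C 0)"
      by (rule char_poly_matrix[OF C])
    also have "- char_matrix C 0 = (- 1) \<cdot>\<^sub>m C"
      using C by (intro eq_matI) (auto simp: char_matrix_def)
    also have "det \<dots> = - of_int (det A)"
      using C by (simp add: det_smult C_def of_int_hom.hom_det)
    finally have "- (a * b * c) = - complex_of_int (det A)" by (simp add: cp ac_simps)
    then have "cmod (a * b * c) = cmod (of_int (det A))" by simp
    also have "\<dots> = of_int \<bar>det A\<bar>" by simp
    also have "\<dots> = 1" unfolding det by simp
    finally show ?thesis by (simp add: norm_mult)
  qed
  have root: "poly (char_poly C) z = 0 \<longleftrightarrow> z \<in> {a, b, c}" for z
    unfolding cp by (auto simp del: mult_pCons_left mult_pCons_right)
  consider "x = a" | "x = b" | "x = c" using x root[of x] by (auto simp: C_def)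
  then show ?thesis
  proof cases
    case 1
    show ?thesis
      by (rule that[of b c]) (use 1 mset norm root in \<open>simp_all add: C_def ac_simps\<close>)
  next
    case 2
    show ?thesis
      by (rule that[of a c]) (use 2 mset norm root in \<open>auto simp: C_def ac_simps add_mset_commute\<close>)
  next
    case 3
    show ?thesis
      by (rule that[of a b]) (use 3 mset norm root in \<open>auto simp: C_def ac_simps add_mset_commute\<close>)
  qed
qed

section \<open>Conjugate, real and imaginary parts of eigenvectors\<close>

definition tmap :: "('a \<Rightarrow> 'b) \<Rightarrow> 'a triple \<Rightarrow> 'b triple" where
  "tmap f v = (case v of (x, y, z) \<Rightarrow> (f x, f y, f z))"

lemma mv_tmap_of_int: "mv A (tmap of_int v) = tmap of_int (mv A v)"
  by (cases v rule: prod_cases3) (simp add: mv_def tmap_def)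

lemma mv_tmap_of_real:
  "mv A (tmap complex_of_real v) = tmap complex_of_real (mv A v)"
  by (cases v rule: prod_cases3) (simp add: mv_def tmap_def)

lemma mv_tmap_cnj: "mv A (tmap cnj v) = tmap cnj (mv A v)"
  by (cases v rule: prod_cases3) (simp add: mv_def tmap_def)

lemma mv_tmap_Re: "mv A (tmap Re v) = tmap Re (mv A v)"
  by (cases v rule: prod_cases3) (simp add: mv_def tmap_def)

lemma mv_tmap_Im: "mv A (tmap Im v) = tmap Im (mv A v)"
  by (cases v rule: prod_cases3) (simp add: mv_def tmap_def)

lemma char_poly_cnj_root:
  assumes "A \<in> carrier_mat 3 3" "poly (char_poly (map_mat complex_of_int A)) z = 0"
  shows "poly (char_poly (map_mat complex_of_int A)) (cnj z) = 0"
proof -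
  obtain v :: "complex triple" where v: "v \<noteq> (0, 0, 0)" "mv A v = smul z v"
    using assms eigenvalue_iff_triple by blast
  have "mv A (tmap cnj v) = smul (cnj z) (tmap cnj v)"
    unfolding mv_tmap_cnj v(2) by (cases v rule: prod_cases3) (simp add: tmap_def smul_def)
  moreover have "tmap cnj v \<noteq> (0, 0, 0)"
    using v(1) by (cases v rule: prod_cases3) (simp add: tmap_def)
  ultimately show ?thesis using assms(1) eigenvalue_iff_triple by blast
qed

text \<open>For a real eigenvalue the real and imaginary parts of a complex eigenvector satisfy the
  same equation, since the matrix is real, and they are not both zero.\<close>

lemma char_poly_real_root_iff:
  assumes "A \<in> carrier_mat 3 3"
  shows "poly (char_poly (map_mat complex_of_int A)) (of_real z) = 0 \<longleftrightarrow>
    (\<exists>v :: real triple. v \<noteq> (0, 0, 0) \<and> mv A v = smul z v)"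
proof
  assume "poly (char_poly (map_mat complex_of_int A)) (of_real z) = 0"
  then obtain v :: "complex triple" where v: "v \<noteq> (0, 0, 0)" "mv A v = smul (of_real z) v"
    using assms eigenvalue_iff_triple by blast
  have "mv A (tmap Re v) = smul z (tmap Re v)" "mv A (tmap Im v) = smul z (tmap Im v)"
    unfolding mv_tmap_Re mv_tmap_Im v(2)
    by (cases v rule: prod_cases3, simp add: tmap_def smul_def)+
  moreover have "tmap Re v \<noteq> (0, 0, 0) \<or> tmap Im v \<noteq> (0, 0, 0)"
    using v(1) by (cases v rule: prod_cases3) (auto simp add: tmap_def complex_eq_iff)
  ultimately show "\<exists>v :: real triple. v \<noteq> (0, 0, 0) \<and> mv A v = smul z v" by blast
next
  assume "\<exists>v :: real triple. v \<noteq> (0, 0, 0) \<and> mv A v = smul z v"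
  then obtain v :: "real triple" where v: "v \<noteq> (0, 0, 0)" "mv A v = smul z v" by blast
  have "mv A (tmap of_real v) = smul (complex_of_real z) (tmap of_real v)"
    unfolding mv_tmap_of_real v(2) by (cases v rule: prod_cases3) (simp add: tmap_def smul_def)
  moreover have "tmap complex_of_real v \<noteq> (0, 0, 0)"
    using v(1) by (cases v rule: prod_cases3) (simp add: tmap_def)
  ultimately show "poly (char_poly (map_mat complex_of_int A)) (of_real z) = 0"
    using assms eigenvalue_iff_triple by blast
qed

section \<open>Primitivity and the Pisot property under condition (3)\<close>

lemma letter_nonneg: "\<forall>i<3. \<forall>j<3. 0 \<le> letter c $$ (i, j)"
  unfolding all_less_3 by (cases c; simp add: letter_def S_a_def S_b_def mat_of_rows_list_def)

lemma word_mat_nonneg: "i < 3 \<Longrightarrow> j < 3 \<Longrightarrow> 0 \<le> word_mat w $$ (i, j)"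
proof (induction w arbitrary: i j)
  case (Cons c w)
  show ?case
    unfolding word_mat_simps index_mult_mat_3[OF letter_carrier word_mat_carrier Cons.prems]
    using Cons letter_nonneg by (intro add_nonneg_nonneg mult_nonneg_nonneg) auto
qed simp

lemma nonneg_word_mat: "square_mat (word_mat w)" "nonneg_mat (word_mat w)"
proof -
  have d: "dim_row (word_mat w) = 3" "dim_col (word_mat w) = 3"
    using word_mat_carrier[of w] by simp_all
  show "square_mat (word_mat w)" by (simp add: d)
  show "nonneg_mat (word_mat w)"
    unfolding nonneg_mat_def using word_mat_nonneg[of _ _ w] d by (auto dest!: elements_matD)
qed

lemma primitive_word_mat:
  assumes "w \<noteq> []" and X: "both_parities (periodic_word w)"
  shows "primitive_mat (word_mat w)"
proof -
  let ?M = "word_mat w" and ?X = "periodic_word w"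
  let ?e = "(1, 0, 0) :: int triple" and ?f = "(0, 1, 0) :: int triple" and ?g = "(0, 0, 1) :: int triple"
  obtain k1 k2 k3 where k: "pos_triple (orbit ?X ?e k1)" "pos_triple (orbit ?X ?f k2)" "pos_triple (orbit ?X ?g k3)"
    using orbit_eventually_pos[OF X, of ?e] orbit_eventually_pos[OF X, of ?f]
      orbit_eventually_pos[OF X, of ?g] by auto
  \<comment> \<open>The exponent exceeds all three waiting times, and \<open>Suc\<close> keeps it
    positive as \<open>primitive_mat\<close> demands. The images of the three unit vectors are the
    columns of the power.\<close>
  define m where "m = Suc (k1 + k2 + k3)"
  have "m \<le> length w * m" using assms(1) by (cases w) auto
  then have "k1 \<le> length w * m" "k2 \<le> length w * m" "k3 \<le> length w * m"
    unfolding m_def by linarith+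
  then have "pos_triple (mv (?M ^\<^sub>m m) ?e)" "pos_triple (mv (?M ^\<^sub>m m) ?f)" "pos_triple (mv (?M ^\<^sub>m m) ?g)"
    using k pos_orbit_mono unfolding mv_pow[OF word_mat_carrier] orbit_periodic_word_mult[symmetric]
    by blast+
  then have "\<forall>i<3. \<forall>j<3. 0 < (?M ^\<^sub>m m) $$ (i, j)"
    unfolding all_less_3 by (simp add: mv_def)
  moreover have "dim_row (?M ^\<^sub>m m) = 3" "dim_col (?M ^\<^sub>m m) = 3"
    using pow_carrier_mat[OF word_mat_carrier[of w], of m] by (metis carrier_matD)+
  ultimately have "pos_mat (?M ^\<^sub>m m)"
    unfolding pos_mat_def by (auto dest!: elements_matD)
  then show ?thesis
    unfolding primitive_mat_def using nonneg_word_mat by (auto simp: m_def)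
qed

lemma pisot_word_mat:
  assumes "w \<noteq> []" and X: "both_parities (periodic_word w)"
  shows "pisot_mat (word_mat w)"
proof -
  define C where "C = map_mat complex_of_int (word_mat w)"
  have C: "C \<in> carrier_mat 3 3" using word_mat_carrier by (simp add: C_def)
  obtain r :: "real triple" and l where r: "pos_triple r" "1 < l" "mv (word_mat w) r = smul l r"
    using perron_vector[OF assms] .
  have "r \<noteq> (0, 0, 0)" using r(1) by auto
  then have "poly (char_poly C) (of_real l) = 0"
    unfolding C_def char_poly_real_root_iff[OF word_mat_carrier] using r(3) by blast
  then obtain b c where mset: "eigenvalue_mset C = {#of_real l, b, c#}"
    and norm: "cmod (of_real l) * cmod b * cmod c = 1"
    and root: "\<And>z. poly (char_poly C) z = 0 \<longleftrightarrow> z \<in> {of_real l, b, c}"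
    using char_poly_roots[OF word_mat_carrier abs_det_word_mat] unfolding C_def by metis
  have norm: "l * (cmod b * cmod c) = 1" using norm r(2) by (simp add: mult.assoc)
  have cnj: "cnj z \<in> {of_real l, b, c}" if "z \<in> {of_real l, b, c}" for z
    using char_poly_cnj_root[OF word_mat_carrier, of w z] that root by (simp add: C_def)
  have real: "1 < cmod z * l" if "z \<in> {b, c}" "z \<in> \<real>" for z
  proof -
    obtain x where x: "z = of_real x" using \<open>z \<in> \<real>\<close> by (auto elim: Reals_cases)
    have "poly (char_poly C) (of_real x) = 0" using root that x by auto
    then obtain u :: "real triple" where "u \<noteq> (0, 0, 0)" "mv (word_mat w) u = smul x u"
      unfolding C_def char_poly_real_root_iff[OF word_mat_carrier] by blast
    then have "1 < \<bar>x\<bar> * l"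
      using abs_eigenvalue_times_perron_gt_1[OF assms r(1,3)] r(2) by simp
    then show ?thesis by (simp add: x)
  qed
  \<comment> \<open>The product of the three moduli is 1, so a lower bound on one real root relative
    to 1 / l bounds the other root from above.\<close>
  have less: "cmod z < 1" if "1 < cmod z' * l" "l * (cmod z' * cmod z) = 1" for z z'
  proof (rule ccontr)
    assume "\<not> cmod z < 1"
    then have "(cmod z' * l) * 1 \<le> (cmod z' * l) * cmod z" using that(1) by (intro mult_left_mono) auto
    then show False using that by (simp add: ac_simps)
  qed
  have bc: "cmod b < 1 \<and> cmod c < 1"
  proof (cases "b \<in> \<real> \<and> c \<in> \<real>")
    case True
    then show ?thesis
      using less[of b c] less[of c b] real[of b] real[of c] norm by (simp add: ac_simps)
  next
    case False
    \<comment> \<open>Conjugation permutes the roots and fixes l, so if \<open>b\<close> or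
      \<open>c\<close> is not real, the two are conjugate and have equal modulus.\<close>
    have "cnj z = of_real l \<longleftrightarrow> z = of_real l" for z
      by (metis complex_cnj_cnj complex_cnj_complex_of_real)
    then have "c = cnj b"
      using False cnj[of b] cnj[of c] by (auto simp: Reals_cnj_iff)
    then have "l * (cmod b)\<^sup>2 = 1" using norm by (simp add: power2_eq_square)
    then have "(cmod b)\<^sup>2 = 1 / l" using r(2) by (simp add: field_simps)
    also have "\<dots> < 1" using r(2) by simp
    finally have "cmod b < 1" by (simp add: abs_square_less_1)
    then show ?thesis using \<open>c = cnj b\<close> by simp
  qed
  have "spectral_radius C = l"
  proof -
    have "spectrum C = {of_real l, b, c}"
      unfolding spectrum_root_char_poly[OF C] using root by auto
    then show ?thesis unfolding spectral_radius_def using bc r(2) by (auto simp: max_def)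
  qed
  then have "eigenvalue_mset C - {#complex_of_real (spectral_radius C)#} = {#b, c#}"
    by (simp add: mset)
  then show ?thesis
    unfolding pisot_mat_def Let_def using nonneg_word_mat bc by (simp add: C_def)
qed

text \<open>If e is the fixed row vector of M^2, then e + e M is a left eigenvector of M for the eigenvalue 1.\<close>

lemma char_poly_root_1_fixed_row:
  assumes M: "M \<in> carrier_mat 3 3" "\<And>i j. i < 3 \<Longrightarrow> j < 3 \<Longrightarrow> 0 \<le> M $$ (i, j)"
    and i: "i < 3" "fixed_row i (M ^\<^sub>m 2)"
  shows "poly (char_poly (map_mat complex_of_int M)) 1 = 0"
proof -
  define N where "N = transpose_mat M"
  define u where "u j = (if j = i then 1 else 0) + M $$ (i, j)" for j
  have N: "N \<in> carrier_mat 3 3" using M(1) by (simp add: N_def)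
  have Ne: "N $$ (j, k) = M $$ (k, j)" if "j < 3" "k < 3" for j k
    using M(1) that by (simp add: N_def)
  have sq: "M $$ (i, 0) * M $$ (0, j) + M $$ (i, 1) * M $$ (1, j) + M $$ (i, 2) * M $$ (2, j) =
     (if j = i then 1 else 0)" if "j < 3" for j
    using i that unfolding fixed_row_def pow_mat_2[OF M(1)]
    by (simp add: index_mult_mat_3[OF M(1) M(1)] del: index_mult_mat)
  have "M $$ (0, j) * u 0 + M $$ (1, j) * u 1 + M $$ (2, j) * u 2 = u j" if "j < 3" for j
    using sq[OF that] i(1) by (auto simp: u_def less_3_iff algebra_simps)
  then have eq: "mv N (u 0, u 1, u 2) = (u 0, u 1, u 2)"
    by (simp add: mv_def Ne)
  have "0 < u i" using M(2)[OF i(1) i(1)] by (simp add: u_def)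
  then have nz: "tmap complex_of_int (u 0, u 1, u 2) \<noteq> (0, 0, 0)"
    using i(1) by (auto simp: tmap_def less_3_iff)
  have "mv N (tmap complex_of_int (u 0, u 1, u 2)) = smul 1 (tmap complex_of_int (u 0, u 1, u 2))"
    unfolding mv_tmap_of_int eq by (simp add: smul_1)
  then have "poly (char_poly (map_mat complex_of_int N)) 1 = 0"
    using nz eigenvalue_iff_triple[OF N] by blast
  moreover have "map_mat complex_of_int N = transpose_mat (map_mat complex_of_int M)"
    using M(1) by (intro eq_matI) (auto simp: N_def)
  moreover have "map_mat complex_of_int M \<in> carrier_mat 3 3" using M(1) by simp
  ultimately show ?thesis by simp
qed

text \<open>The number 1 is an eigenvalue. If the spectral radius is not 1, this eigenvalue survives
  its removal; otherwise two eigenvalues remain whose moduli have product 1, so they cannot both be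
  less than 1.\<close>

lemma not_pisot_fixed_row:
  assumes i: "i < 3" "fixed_row i (word_mat w ^\<^sub>m 2)"
  shows "\<not> pisot_mat (word_mat w)"
proof
  define C where "C = map_mat complex_of_int (word_mat w)"
  assume "pisot_mat (word_mat w)"
  then have *: "cmod z < 1" if "z \<in># eigenvalue_mset C - {#complex_of_real (spectral_radius C)#}" for z
    using that unfolding pisot_mat_def by (simp add: C_def Let_def)
  obtain b c where mset: "eigenvalue_mset C = {#1, b, c#}" and norm: "cmod 1 * cmod b * cmod c = 1"
    using char_poly_roots[OF word_mat_carrier abs_det_word_mat
      char_poly_root_1_fixed_row[OF word_mat_carrier word_mat_nonneg i]] unfolding C_def by metis
  have "complex_of_real (spectral_radius C) = 1"
  proof (rule ccontr)
    assume "complex_of_real (spectral_radius C) \<noteq> 1"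
    then have "1 \<in># eigenvalue_mset C - {#complex_of_real (spectral_radius C)#}"
      by (simp add: mset)
    then show False using *[of 1] by simp
  qed
  then have "cmod b < 1" "cmod c < 1" using * by (auto simp: mset)
  then have "cmod b * cmod c < 1" using mult_strict_mono[of "cmod b" 1 "cmod c" 1] by simp
  then show False using norm by simp
qed

theorem theorem5p3:
  fixes M :: "int mat" and n :: nat
  assumes "n \<ge> 1"
    and "M \<in> mat_products 3 {S_a, S_b} n"
  shows "(primitive_mat M \<longleftrightarrow> pisot_mat M) \<and>
    (pisot_mat M \<longleftrightarrow>
      M ^\<^sub>m 2 \<notin> mat_products 3 {S_a * S_b, S_b ^\<^sub>m 2} n \<union> mat_products 3 {S_b * S_a, S_b ^\<^sub>m 2} n)"
proof -
  obtain w where w: "length w = n" "M = word_mat w"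
    using mat_products_letters[OF assms(2)] .
  show ?thesis
  proof (cases "M ^\<^sub>m 2 \<in> mat_products 3 {S_a * S_b, S_b ^\<^sub>m 2} n \<union> mat_products 3 {S_b * S_a, S_b ^\<^sub>m 2} n")
    case True
    then obtain i where "i < 3" "fixed_row i (M ^\<^sub>m 2)" by (rule reducible_fixed_row)
    then have "\<not> primitive_mat M" "\<not> pisot_mat M"
      using not_primitive_fixed_row not_pisot_fixed_row word_mat_carrier unfolding w(2) by blast+
    then show ?thesis using True by blast
  next
    case False
    \<comment> \<open>Contraposition: were all odd or all even positions of \<open>w @ w\<close>
      filled by b, the square would lie in one of the two excluded sets.\<close>
    then obtain i j where "i < n" "(w @ w) ! (2 * i + 1)" "j < n" "(w @ w) ! (2 * j)"
      using square_in_mat_products[OF w] by blast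
    then have "both_parities (periodic_word w)"
      using both_parities_periodic_word[OF w(1) assms(1)] by blast
    moreover have "w \<noteq> []" using w(1) assms(1) by auto
    ultimately show ?thesis
      using False primitive_word_mat pisot_word_mat w(2) by blast
  qed
qed

end
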